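(* Let $k\ge1$ be an integer, and suppose $\mathrm{ITV}_i=[m_i,M_i]$ is a real interval for every $i\in\{1,\dots,k\}$. Then for every monotone continuous function $f:\mathbb{R}^k\to\mathbb{R}$, $\mathcal{CR}^f(\mathrm{BPP}_k)\le z_f^k$.
   Context: Fix reals $0<m_i\le M_i$, $i=1,\dots,k$; the price set for objective $i$ is $\mathrm{ITV}_i=[m_i,M_i]$. An input is a finite sequence $I=(\vec p_1,\dots,\vec p_T)$, $T\ge1$, of price vectors $\vec p_t=(p_t^1,\dots,p_t^k)\in \mathrm{ITV}_1\times\cdots\times\mathrm{ITV}_k$. A (deterministic) online algorithm $\mathrm{ALG}_k$ knows all $m_i,M_i$; at time $t$ it sees $\vec p_t$ and must irrevocably accept or reject it, the decision depending only on $\vec p_1,\dots,\vec p_t$. If it accepts $\vec p_t$ the game ends and its return is $\mathrm{ALG}_k(I)=\vec p_t$; if it rejects every price vector its return is $(m_1,\dots,m_k)$. $\vec x\preceq\vec y$ means $x_i\le y_i$ for all $i$; $f$ is monotone if $\vec x\preceq\vec y$ implies $f(\vec x)\le f(\vec y)$. $\mathrm{OPT}_k[I]$ is the set of price vectors $\vec p_t$ of $I$ such that no price vector $\vec p_s\neq \vec p_t$ of $I$ satisfies $\vec p_t\preceq\vec p_s$. $\mathcal{CR}^f(\mathrm{ALG}_k;I)=\sup_{\vec x\in\mathrm{OPT}_k[I]} f(x_1/\mathrm{ALG}_k(I)_1,\dots,x_k/\mathrm{ALG}_k(I)_k)$ and $\mathcal{CR}^f(\mathrm{ALG}_k)=\sup_I\mathcal{CR}^f(\mathrm{ALG}_k;I)$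 over all inputs. $\mathrm{BPP}_k$ (Balanced Price Policy): for $t=1,\dots,T$, accept $\vec p_t$ (the first time this holds) if $f(M_1/p_t^1,\dots,M_k/p_t^k)\le f(p_t^1/m_1,\dots,p_t^k/m_k)$. Finally $\mathcal{S}_f^k=\{(x_1,\dots,x_k)\in[m_1,M_1]\times\cdots\times[m_k,M_k]: f(M_1/x_1,\dots,M_k/x_k)=f(x_1/m_1,\dots,x_k/m_k)\}$ and $z_f^k=\sup_{(x_1,\dots,x_k)\in\mathcal{S}_f^k} f(M_1/x_1,\dots,M_k/x_k)$. *)

theory Defs
  imports "HOL-Analysis.Analysis"
begin

text \<open>
  Price vectors are elements of \<open>real ^ 'n\<close>, so \<open>k = CARD('n) \<ge> 1\<close>; the library order on this
  type is the componentwise one. Suprema are taken in the extended reals, so that they are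
  genuine least upper bounds without any boundedness or nonemptiness side conditions.
\<close>

definition vec_quot :: "real ^ 'n \<Rightarrow> real ^ 'n \<Rightarrow> real ^ 'n" where
  "vec_quot x y = (\<chi> i. x $ i / y $ i)"

definition price_box :: "real ^ 'n \<Rightarrow> real ^ 'n \<Rightarrow> (real ^ 'n) set" where
  "price_box m M = {p. \<forall>i. p $ i \<in> {m $ i..M $ i}}"

definition inputs :: "real ^ 'n \<Rightarrow> real ^ 'n \<Rightarrow> (real ^ 'n) list set" where
  "inputs m M = {I. I \<noteq> [] \<and> set I \<subseteq> price_box m M}"

text \<open>
  A deterministic online algorithm is a decision rule on the nonempty history \<open>[p\<^sub>1, \<dots>, p\<^sub>t]\<close>:
  \<open>True\<close> means that \<open>p\<^sub>t\<close> is accepted. The game ends at the first acceptance, so later values of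
  the rule are irrelevant.
\<close>

type_synonym 'n online_alg = "(real, 'n) vec list \<Rightarrow> bool"

definition accepts_at :: "'n online_alg \<Rightarrow> (real ^ 'n) list \<Rightarrow> nat \<Rightarrow> bool" where
  "accepts_at A I t \<longleftrightarrow> t < length I \<and> A (take (Suc t) I)"

definition alg_return :: "real ^ 'n \<Rightarrow> 'n online_alg \<Rightarrow> (real ^ 'n) list \<Rightarrow> real ^ 'n" where
  "alg_return m A I = (if \<exists>t. accepts_at A I t then I ! (LEAST t. accepts_at A I t) else m)"

definition opt_set :: "(real ^ 'n) list \<Rightarrow> (real ^ 'n) set" where
  "opt_set I = {p \<in> set I. \<not> (\<exists>q \<in> set I. q \<noteq> p \<and> p \<le> q)}"

definition comp_ratio_on ::
    "(real ^ 'n \<Rightarrow> real) \<Rightarrow> real ^ 'n \<Rightarrow> 'n online_alg \<Rightarrow> (real ^ 'n) list \<Rightarrow> ereal" where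
  "comp_ratio_on f m A I = (SUP x\<in>opt_set I. ereal (f (vec_quot x (alg_return m A I))))"

definition comp_ratio ::
    "(real ^ 'n \<Rightarrow> real) \<Rightarrow> real ^ 'n \<Rightarrow> real ^ 'n \<Rightarrow> 'n online_alg \<Rightarrow> ereal" where
  "comp_ratio f m M A = (SUP I\<in>inputs m M. comp_ratio_on f m A I)"

definition bpp :: "(real ^ 'n \<Rightarrow> real) \<Rightarrow> real ^ 'n \<Rightarrow> real ^ 'n \<Rightarrow> 'n online_alg" where
  "bpp f m M ps \<longleftrightarrow> f (vec_quot M (last ps)) \<le> f (vec_quot (last ps) m)"

definition balanced_set :: "(real ^ 'n \<Rightarrow> real) \<Rightarrow> real ^ 'n \<Rightarrow> real ^ 'n \<Rightarrow> (real ^ 'n) set" where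
  "balanced_set f m M = {x \<in> price_box m M. f (vec_quot M x) = f (vec_quot x m)}"

definition balanced_sup :: "(real ^ 'n \<Rightarrow> real) \<Rightarrow> real ^ 'n \<Rightarrow> real ^ 'n \<Rightarrow> ereal" where
  "balanced_sup f m M = (SUP x\<in>balanced_set f m M. ereal (f (vec_quot M x)))"

end

theory Submission
  imports Defs
begin

text \<open>
  On the price box, \<open>x \<mapsto> f (M / x)\<close> is antitone and \<open>x \<mapsto> f (x / m)\<close> is monotone; the first
  dominates at \<open>m\<close>, the second at \<open>M\<close>. If BPP accepts \<open>p\<close>, its ratio is at most \<open>f (M / p)\<close>, and by
  the intermediate value theorem the segment from \<open>m\<close> to \<open>p\<close> contains a balanced point
  \<open>y \<le> p\<close>, where \<open>f (M / y) \<ge> f (M / p)\<close>. If BPP rejects everything, the ratio is some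
  \<open>f (x / m)\<close> with \<open>x\<close> rejected, and the segment from \<open>x\<close> to \<open>M\<close> contains a balanced point \<open>y \<ge> x\<close>,
  where \<open>f (M / y) = f (y / m) \<ge> f (x / m)\<close>.
\<close>

lemma mem_price_box_iff: "x \<in> price_box m M \<longleftrightarrow> m \<le> x \<and> x \<le> M"
  by (auto simp: price_box_def less_eq_vec_def)

lemma vec_quot_mono_left:
  assumes "\<And>i. 0 < y $ i" "x \<le> x'"
  shows "vec_quot x y \<le> vec_quot x' y"
  using assms by (auto simp: vec_quot_def less_eq_vec_def intro!: divide_right_mono intro: less_imp_le)

lemma vec_quot_antimono_right:
  assumes "\<And>i. 0 \<le> x $ i" "\<And>i. 0 < y $ i" "y \<le> y'"
  shows "vec_quot x y' \<le> vec_quot x y"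
  using assms by (auto simp: vec_quot_def less_eq_vec_def intro!: divide_left_mono mult_pos_pos)
    (meson order_less_le_trans)

text \<open>Along the segment from \<open>a\<close> to \<open>b\<close> every coordinate stays
  positive, so both quotients vary continuously. The gap \<open>d\<close> between the two sides of
  the balance equation goes from nonpositive to nonnegative, and a zero of \<open>d\<close> is a
  balanced point.\<close>

lemma balanced_point_between:
  fixes m M a b :: "real ^ 'n"
  assumes m: "\<And>i. 0 < m $ i" and f: "continuous_on UNIV f"
    and ab: "m \<le> a" "a \<le> b" "b \<le> M"
    and fa: "f (vec_quot a m) \<le> f (vec_quot M a)"
    and fb: "f (vec_quot M b) \<le> f (vec_quot b m)"
  obtains y where "y \<in> balanced_set f m M" "a \<le> y" "y \<le> b"
proof -
  define c where "c t = (\<chi> i. a $ i + t * (b $ i - a $ i))" for t :: real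
  have between: "a \<le> c t \<and> c t \<le> b" if "0 \<le> t" "t \<le> 1" for t
  proof -
    have "0 \<le> t * (b $ i - a $ i) \<and> t * (b $ i - a $ i) \<le> b $ i - a $ i" for i
      using ab(2) that by (auto simp: less_eq_vec_def mult_left_le_one_le)
    then show ?thesis
      by (auto simp: c_def less_eq_vec_def) (metis le_diff_eq add.commute)
  qed
  have pos: "c t $ i > 0" if "0 \<le> t" "t \<le> 1" for t i
    using between[OF that] ab(1) m[of i]
    by (meson less_eq_vec_def order_less_le_trans)
  define d where "d t = f (vec_quot (c t) m) - f (vec_quot M (c t))" for t
  have c: "continuous_on {0..1} c"
    unfolding c_def by (intro continuous_intros)
  have num: "continuous_on {0..1} (\<lambda>t. vec_quot (c t) m)"
    unfolding vec_quot_def using m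
    by (intro continuous_intros c) (simp add: less_imp_neq[symmetric])
  have den: "continuous_on {0..1} (\<lambda>t. vec_quot M (c t))"
    unfolding vec_quot_def using pos
    by (intro continuous_intros c) (auto simp: less_imp_neq[symmetric])
  have cont: "continuous_on {0..1} d"
    unfolding d_def
    by (intro continuous_on_diff continuous_on_compose2[OF f num] continuous_on_compose2[OF f den])
      simp_all
  have "c 0 = a" "c 1 = b"
    by (simp_all add: c_def vec_eq_iff)
  then have "d 0 \<le> 0" "0 \<le> d 1"
    using fa fb by (simp_all add: d_def)
  then obtain t where t: "0 \<le> t" "t \<le> 1" "d t = 0"
    using IVT'[of d 0 0 1] cont by auto
  show thesis
  proof (rule that)
    show "a \<le> c t" "c t \<le> b"
      using between t by auto
    then show "c t \<in> balanced_set f m M"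
      using t(3) ab by (auto simp: balanced_set_def mem_price_box_iff d_def)
  qed
qed

text \<open>Trades the \<open>LEAST\<close> for what the ratio bounds consume: the returned price
  passes the test, or every price fails it and the default \<open>m\<close> is returned.\<close>

lemma alg_return_cases:
  obtains (accept) t where "t < length I" "A (take (Suc t) I)" "alg_return m A I = I ! t"
  | (reject) "\<And>t. t < length I \<Longrightarrow> \<not> A (take (Suc t) I)" "alg_return m A I = m"
proof (cases "\<exists>t. accepts_at A I t")
  case True
  then have "accepts_at A I (LEAST t. accepts_at A I t)"
    by (rule LeastI_ex)
  then have "(LEAST t. accepts_at A I t) < length I" "A (take (Suc (LEAST t. accepts_at A I t)) I)"
    unfolding accepts_at_def[of A I "LEAST t. accepts_at A I t"] by auto
  with True show thesis
    by (intro accept) (auto simp: alg_return_def)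
next
  case False
  then show thesis
    by (intro reject) (auto simp: accepts_at_def alg_return_def)
qed

lemma bpp_take_Suc:
  "t < length I \<Longrightarrow>
    bpp f m M (take (Suc t) I) \<longleftrightarrow> f (vec_quot M (I ! t)) \<le> f (vec_quot (I ! t) m)"
  by (simp add: bpp_def take_Suc_conv_app_nth)

theorem theorem2:
  fixes m M :: "real ^ 'n" and f :: "real ^ 'n \<Rightarrow> real"
  assumes "\<And>i. 0 < m $ i" and "\<And>i. m $ i \<le> M $ i"
    and "mono f" and "continuous_on UNIV f"
  shows "comp_ratio f m M (bpp f m M) \<le> balanced_sup f m M"
  unfolding comp_ratio_def comp_ratio_on_def
proof (intro SUP_least)
  fix I x
  assume I: "I \<in> inputs m M" and "x \<in> opt_set I"
  then have xI: "x \<in> set I" and box: "\<And>p. p \<in> set I \<Longrightarrow> m \<le> p \<and> p \<le> M"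
    by (auto simp: opt_set_def inputs_def mem_price_box_iff subset_iff)
  have mM: "m \<le> M"
    using assms(2) by (simp add: less_eq_vec_def)
  have pos: "0 < y $ i" if "m \<le> y" for y i
    using that assms(1)[of i] by (meson less_eq_vec_def order_less_le_trans)
  have quot_refl: "vec_quot y y = 1" if "m \<le> y" for y
    using pos[OF that] by (auto simp: vec_quot_def vec_eq_iff less_imp_neq[symmetric])
  \<comment> \<open>Here \<open>1\<close> is the all-ones vector, equal to both
    \<open>vec_quot m m\<close> and \<open>vec_quot M M\<close>. Hence this one inequality supplies
    the sign condition at \<open>m\<close> in the accepting case and at \<open>M\<close> in the
    rejecting case.\<close>
  have ends: "f 1 \<le> f (vec_quot M m)"
    using vec_quot_mono_left[OF assms(1) mM] quot_refl[of m] assms(3) by (simp add: monoD)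
  \<comment> \<open>An explicit witness also shows that \<open>balanced_set\<close> is nonempty, so
    its supremum is not minus infinity.\<close>
  have "\<exists>y\<in>balanced_set f m M. f (vec_quot x (alg_return m (bpp f m M) I)) \<le> f (vec_quot M y)"
  proof (cases rule: alg_return_cases[of I "bpp f m M" m])
    case (accept t)
    let ?p = "I ! t"
    have p: "m \<le> ?p" "?p \<le> M"
      using box accept(1) by auto
    have acc: "f (vec_quot M ?p) \<le> f (vec_quot ?p m)"
      using accept by (simp add: bpp_take_Suc)
    obtain y where y: "y \<in> balanced_set f m M" "m \<le> y" "y \<le> ?p"
      by (rule balanced_point_between[OF assms(1,4) order_refl p _ acc])
        (use ends quot_refl[of m] in simp_all)
    have "vec_quot x ?p \<le> vec_quot M ?p"
      using box[OF xI] pos[OF p(1)] by (intro vec_quot_mono_left) auto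
    also have "\<dots> \<le> vec_quot M y"
      using pos[OF mM] pos[OF y(2)] y(3) by (intro vec_quot_antimono_right) (auto intro: less_imp_le)
    finally have "f (vec_quot x ?p) \<le> f (vec_quot M y)"
      by (rule monoD[OF assms(3)])
    then show ?thesis
      using y accept(3) by auto
  next
    case reject
    \<comment> \<open>The optimum \<open>x\<close> is itself one of the rejected prices, so the
      failed test at \<open>x\<close> gives the sign condition at the lower end of the segment from
      \<open>x\<close> to \<open>M\<close>.\<close>
    from xI obtain t where "t < length I" "x = I ! t"
      by (auto simp: in_set_conv_nth)
    with reject(1) have rej: "f (vec_quot x m) \<le> f (vec_quot M x)"
      by (auto simp: bpp_take_Suc not_le intro: less_imp_le)
    have x: "m \<le> x" "x \<le> M"
      using box[OF xI] by auto
    obtain y where y: "y \<in> balanced_set f m M" "x \<le> y" "y \<le> M"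
      by (rule balanced_point_between[OF assms(1,4) x order_refl rej])
        (use ends quot_refl[OF mM] in simp_all)
    have "f (vec_quot x m) \<le> f (vec_quot y m)"
      by (intro monoD[OF assms(3)] vec_quot_mono_left assms(1) y)
    also have "\<dots> = f (vec_quot M y)"
      using y(1) by (simp add: balanced_set_def)
    finally show ?thesis
      using y(1) reject(2) by auto
  qed
  then show "ereal (f (vec_quot x (alg_return m (bpp f m M) I))) \<le> balanced_sup f m M"
    unfolding balanced_sup_def by (auto intro: SUP_upper2)
qed

end
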